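(* Let $n\geq 3$ be an integer and let $i\neq j$ be two vertices of the cycle graph $C_n$. Then $\{i,j\}$ is a driver set for $C_n$ if and only if $\gcd(2d,n)\in\{1,2\}$, where $d=d(i,j)$ denotes the distance between the vertices $i$ and $j$ in $C_n$.
   Context: $C_n$ is the simple undirected cycle graph with vertex set $V=\{1,\ldots,n\}$ and edge set $\{\{1,2\},\{2,3\},\ldots,\{n-1,n\},\{1,n\}\}$. The distance $d(i,j)$ is the usual graph distance (number of edges in a shortest path), so $d(i,j)=\min\{|j-i|,n-|j-i|\}$. For a simple undirected graph $G$ on $V=\{1,\ldots,n\}$ with (0-1) adjacency matrix $A$ and a non-empty subset $S=\{i_1,\ldots,i_k\}\subseteq V$, $B_S$ denotes the $(n\times k)$-matrix with columns the standard basis vectors $\mathbf{e}_{i_1},\ldots,\mathbf{e}_{i_k}$. $S$ is called a driver set for $G$ if the linear system $\dot{\mathbf{x}}=A\mathbf{x}+B_S\mathbf{u}$ (the pair $(A,B_S)$) is controllable, i.e. any initial state can be steered to any other state in finite time. *)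

theory Defs
  imports Complex_Main "Jordan_Normal_Form.Matrix"
begin

text \<open>
  Graphs on the vertex set \<open>{1..n}\<close> are given by their set of edges.  Rows and columns of
  the matrices of the library are numbered from \<open>0\<close>, so vertex \<open>v\<close> has index \<open>v - 1\<close>.
\<close>

definition simple_graph :: "nat \<Rightarrow> nat set set \<Rightarrow> bool" where
  "simple_graph n E \<longleftrightarrow> (\<forall>e\<in>E. e \<subseteq> {1..n} \<and> card e = 2)"

definition cycle_graph :: "nat \<Rightarrow> nat set set" where
  "cycle_graph n = {{k, k + 1} | k. 1 \<le> k \<and> k < n} \<union> {{1, n}}"

lemma simple_graph_cycle_graph: "n \<ge> 3 \<Longrightarrow> simple_graph n (cycle_graph n)"
  by (auto simp: simple_graph_def cycle_graph_def)

text \<open>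
  The length of a shortest walk, which is also that of a shortest path.  It is meaningful only
  for vertices in the same component.
\<close>

definition graph_dist :: "nat set set \<Rightarrow> nat \<Rightarrow> nat \<Rightarrow> nat" where
  "graph_dist E v w = (LEAST l. (v, w) \<in> {(a, b). {a, b} \<in> E} ^^ l)"

definition adjacency_matrix :: "nat \<Rightarrow> nat set set \<Rightarrow> real mat" where
  "adjacency_matrix n E = mat n n (\<lambda>(r, c). if {r + 1, c + 1} \<in> E then 1 else 0)"

definition input_matrix :: "nat \<Rightarrow> nat set \<Rightarrow> real mat" where
  "input_matrix n S = mat_of_cols n (map (\<lambda>v. unit_vec n (v - 1)) (sorted_list_of_set S))"

text \<open>
  Finitely many discontinuities in \<open>{a..b}\<close>, all with finite one-sided limits.  At the end
  points, the condition on the outer one-sided limit is vacuous.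
\<close>

definition piecewise_continuous :: "real \<Rightarrow> real \<Rightarrow> (real \<Rightarrow> real) \<Rightarrow> bool" where
  "piecewise_continuous a b f \<longleftrightarrow>
     (\<exists>F. finite F \<and> (\<forall>t\<in>{a..b} - F. continuous (at t within {a..b}) f)) \<and>
     (\<forall>t\<in>{a..b}. (\<exists>l. (f \<longlongrightarrow> l) (at t within {a..<t})) \<and> (\<exists>l. (f \<longlongrightarrow> l) (at t within {t<..b})))"

text \<open>
  The state \<open>x\<close> solves \<open>x' = A x + B u\<close> on \<open>{0..T}\<close> for a piecewise continuous input \<open>u\<close>: it is
  continuous, and the equation holds except possibly at finitely many instants, where \<open>u\<close> may
  jump.  Everything is stated componentwise, as vectors of variable dimension carry no topology.
\<close>

definition is_trajectory ::
  "real mat \<Rightarrow> real mat \<Rightarrow> real \<Rightarrow> (real \<Rightarrow> real vec) \<Rightarrow> (real \<Rightarrow> real vec) \<Rightarrow> bool" where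
  "is_trajectory A B T u x \<longleftrightarrow>
     (\<forall>t\<in>{0..T}. u t \<in> carrier_vec (dim_col B) \<and> x t \<in> carrier_vec (dim_row A)) \<and>
     (\<forall>c<dim_col B. piecewise_continuous 0 T (\<lambda>t. u t $ c)) \<and>
     (\<forall>r<dim_row A. continuous_on {0..T} (\<lambda>t. x t $ r)) \<and>
     (\<exists>F. finite F \<and> (\<forall>t\<in>{0..T} - F. \<forall>r<dim_row A.
        ((\<lambda>s. x s $ r) has_real_derivative (A *\<^sub>v x t + B *\<^sub>v u t) $ r) (at t within {0..T})))"

definition controllable :: "real mat \<Rightarrow> real mat \<Rightarrow> bool" where
  "controllable A B \<longleftrightarrow>
     (\<forall>x0\<in>carrier_vec (dim_row A). \<forall>x1\<in>carrier_vec (dim_row A).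
        \<exists>T>0. \<exists>u x. is_trajectory A B T u x \<and> x 0 = x0 \<and> x T = x1)"

definition driver_set :: "nat \<Rightarrow> nat set set \<Rightarrow> nat set \<Rightarrow> bool" where
  "driver_set n E S \<longleftrightarrow>
     S \<noteq> {} \<and> S \<subseteq> {1..n} \<and> controllable (adjacency_matrix n E) (input_matrix n S)"

end

theory Submission
  imports Defs "HOL-Computational_Algebra.Polynomial"
begin

text \<open>
  The eigenspaces of the adjacency matrix of the cycle are spanned by the sampled waves of
  frequency \<open>\<theta> = 2 \<pi> k / n\<close>, with eigenvalue \<open>2 cos \<theta>\<close>.  If \<open>g = gcd (2 d) n \<ge> 3\<close>, then the wave
  \<open>sin (2 \<pi> (v - i) / g)\<close> is an eigenvector that vanishes at both \<open>i\<close> and \<open>j\<close>; its inner product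
  with the state evolves independently of the input.  If \<open>g \<le> 2\<close>, then for every frequency the waves
  \<open>cos (\<theta> (v - i))\<close> and \<open>cos (\<theta> (v - j))\<close> span the eigenspace.  As \<open>e\<^sub>i\<close> is the average of the
  waves \<open>cos (\<theta> (v - i))\<close> over all frequencies, the input at \<open>i\<close> drives the coordinates along these waves by
  \<open>\<alpha>' = \<lambda> \<alpha> + u\<close>, with one distinct \<open>\<lambda>\<close> per frequency, and likewise for \<open>j\<close>.  Such a diagonal
  system is steered between arbitrary states by a polynomial input, so that neither matrix
  exponentials nor Gramians are needed.
\<close>

section \<open>Polynomial jets and the steering of diagonal systems\<close>

lemma poly_higher_pderiv_eq_0:
  fixes p :: "'a::idom poly"
  assumes "[:- a, 1:] ^ Suc k dvd p"
  shows "poly ((pderiv ^^ k) p) a = 0"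
  using assms
proof (induction k arbitrary: p)
  case 0
  then show ?case by (simp add: poly_eq_0_iff_dvd)
next
  case (Suc k)
  then obtain q where "p = [:- a, 1:] ^ Suc (Suc k) * q" by (elim dvdE)
  then have "pderiv p = [:- a, 1:] ^ Suc (Suc k) * pderiv q +
      q * (smult (of_nat (Suc (Suc k))) ([:- a, 1:] ^ Suc k) * pderiv [:- a, 1:])"
    by (simp only: pderiv_mult pderiv_power_Suc)
  moreover have "[:- a, 1:] ^ Suc k dvd \<dots>"
    by (intro dvd_add dvd_mult2 dvd_mult dvd_smult le_imp_power_dvd) simp_all
  ultimately have "[:- a, 1:] ^ Suc k dvd pderiv p" by simp
  then show ?case using Suc.IH by (simp add: funpow_Suc_right del: funpow.simps)
qed

lemma ex_poly_antiderivative: "\<exists>p. pderiv p = (q :: 'a::field_char_0 poly)"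
proof
  show "pderiv (\<Sum>k\<le>degree q. monom (coeff q k / of_nat (Suc k)) (Suc k)) = q"
    by (subst (3) poly_as_sum_of_monoms[symmetric], simp only: higher_pderiv_sum[of 1, simplified] pderiv_monom)
       (simp del: of_nat_Suc add: poly_as_sum_of_monoms)
qed

text \<open>Induction by integration: an antiderivative of a polynomial with the shifted jet has the
  right derivatives, and a constant corrects its value at \<open>a\<close>.\<close>

lemma ex_poly_jet:
  fixes f :: "nat \<Rightarrow> 'a::field_char_0"
  shows "\<exists>p. \<forall>k<r. poly ((pderiv ^^ k) p) a = f k"
proof (induction r arbitrary: f)
  case 0
  then show ?case by simp
next
  case (Suc r)
  obtain q where q: "\<forall>k<r. poly ((pderiv ^^ k) q) a = f (Suc k)"
    using Suc.IH[of "\<lambda>k. f (Suc k)"] by auto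
  obtain p where p: "pderiv p = q" using ex_poly_antiderivative by blast
  let ?p = "p + [:f 0 - poly p a:]"
  have "pderiv ?p = q" by (simp add: p pderiv_add)
  then have "poly ((pderiv ^^ k) ?p) a = f k" if "k < Suc r" for k
    using that q by (cases k) (simp_all add: funpow_Suc_right del: funpow.simps(2))
  then show ?case by blast
qed

text \<open>Chinese remaindering: each jet is realised by its own polynomial, and the two are glued
  modulo the \<open>r\<close>-th powers of \<open>X\<close> and \<open>X - 1\<close>, which leave
  jets below order \<open>r\<close> unchanged.\<close>

lemma hermite_interpolation:
  fixes f g :: "nat \<Rightarrow> 'a::field_char_0"
  shows "\<exists>u. \<forall>k<r. poly ((pderiv ^^ k) u) 0 = f k \<and> poly ((pderiv ^^ k) u) 1 = g k"
proof -
  obtain p q where p: "\<forall>k<r. poly ((pderiv ^^ k) p) 0 = f k"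
    and q: "\<forall>k<r. poly ((pderiv ^^ k) q) 1 = g k"
    using ex_poly_jet by metis
  define X where "X = [:0, 1 :: 'a:]"
  \<comment> \<open>\<open>e\<close> is \<open>0\<close> modulo \<open>X ^ r\<close> and \<open>1\<close> modulo \<open>(X - 1) ^ r\<close>\<close>
  define e where "e = 1 - (1 - X ^ r) ^ r"
  have "1 - (1 - X ^ r) dvd e" unfolding e_def by (metis dvd_triv_left one_diff_power_eq)
  then have "X ^ r dvd e" by simp
  moreover have "[:- 1, 1:] dvd 1 - X ^ r"
    by (simp add: X_def flip: poly_eq_0_iff_dvd)
  then have "[:- 1, 1:] ^ r dvd 1 - e" unfolding e_def by (simp add: dvd_power_same)
  ultimately have d: "[:- 0, 1:] ^ r dvd e * (q - p)" "[:- 1, 1:] ^ r dvd (1 - e) * (p - q)"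
    by (auto simp: X_def)
  define u where "u = p + e * (q - p)"
  \<comment> \<open>The same \<open>u\<close>, seen as a perturbation of \<open>q\<close>, so that
    its jet at 1 can be read off.\<close>
  have u': "u = q + (1 - e) * (p - q)" by (simp add: u_def algebra_simps)
  have "poly ((pderiv ^^ k) u) 0 = f k \<and> poly ((pderiv ^^ k) u) 1 = g k" if "k < r" for k
  proof
    have le: "Suc k \<le> r" using that by simp
    show "poly ((pderiv ^^ k) u) 0 = f k"
      using poly_higher_pderiv_eq_0[OF power_le_dvd[OF d(1) le]] p that
      by (simp add: u_def higher_pderiv_add)
    show "poly ((pderiv ^^ k) u) 1 = g k"
      using poly_higher_pderiv_eq_0[OF power_le_dvd[OF d(2) le]] q that
      by (simp add: u' higher_pderiv_add)
  qed
  then show ?thesis by blast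
qed

text \<open>
  Adding a mode \<open>h\<close>: the old modes are steered by the input \<open>v = \<alpha> h\<close>, whose prescribed jets encode the
  end states of \<open>h\<close>; the substitution \<open>\<alpha> k = v + (l k - l h) \<gamma> k\<close> turns \<open>\<gamma> k' = l k \<gamma> k + v\<close> into
  \<open>\<alpha> k' = l k \<alpha> k + u\<close> for the common input \<open>u = v' - l h v\<close>.
\<close>

lemma diagonal_steering_jets:
  fixes l :: "'k \<Rightarrow> 'a::field_char_0"
  assumes "finite K" and "inj_on l K"
  shows "\<exists>u \<alpha>. (\<forall>k\<in>K. pderiv (\<alpha> k) = smult (l k) (\<alpha> k) + u \<and>
      poly (\<alpha> k) 0 = a k \<and> poly (\<alpha> k) 1 = b k) \<and>
    (\<forall>m<r. poly ((pderiv ^^ m) u) 0 = f m \<and> poly ((pderiv ^^ m) u) 1 = g m)"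
  using assms
proof (induction K arbitrary: a b f g r rule: finite_induct)
  case empty
  then show ?case using hermite_interpolation by auto
next
  case (insert h K)
  define a' where "a' k = (a k - a h) / (l k - l h)" for k
  define b' where "b' k = (b k - b h) / (l k - l h)" for k
  \<comment> \<open>Solving \<open>u = v' - l h v\<close> for \<open>v'\<close> gives this recursion
    for the jets of \<open>v\<close>. Orders up to \<open>r\<close> of \<open>v\<close> control
    orders below \<open>r\<close> of \<open>u\<close>, whence \<open>Suc r\<close> in the induction
    hypothesis.\<close>
  define f' where "f' = rec_nat (a h) (\<lambda>m y. f m + l h * y)"
  define g' where "g' = rec_nat (b h) (\<lambda>m y. g m + l h * y)"
  have rec: "f' 0 = a h" "g' 0 = b h"
    "f' (Suc m) = f m + l h * f' m" "g' (Suc m) = g m + l h * g' m" for m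
    by (simp_all add: f'_def g'_def)
  obtain v \<gamma> where \<gamma>: "\<forall>k\<in>K. pderiv (\<gamma> k) = smult (l k) (\<gamma> k) + v \<and>
      poly (\<gamma> k) 0 = a' k \<and> poly (\<gamma> k) 1 = b' k"
    and v: "\<forall>m<Suc r. poly ((pderiv ^^ m) v) 0 = f' m \<and> poly ((pderiv ^^ m) v) 1 = g' m"
    using insert.IH[where a = a' and b = b' and f = f' and g = g' and r = "Suc r"] insert.prems by auto
  define u where "u = pderiv v + smult (- l h) v"
  define \<alpha> where "\<alpha> k = (if k = h then v else v + smult (l k - l h) (\<gamma> k))" for k
  have "pderiv (\<alpha> k) = smult (l k) (\<alpha> k) + u \<and> poly (\<alpha> k) 0 = a k \<and> poly (\<alpha> k) 1 = b k"
    if k: "k \<in> insert h K" for k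
  proof (cases "k = h")
    case True
    then show ?thesis using v[rule_format, of 0] by (simp add: \<alpha>_def u_def rec)
  next
    case False
    then have kK: "k \<in> K" and ne: "l k \<noteq> l h"
      using k insert.prems insert.hyps by (auto simp: inj_on_def)
    have "pderiv (\<alpha> k) = smult (l k) (\<alpha> k) + u"
      using \<gamma> kK False
      by (intro poly_eqI) (simp add: \<alpha>_def u_def pderiv_add pderiv_smult algebra_simps)
    then show ?thesis using \<gamma> kK False ne v[rule_format, of 0]
      by (simp add: \<alpha>_def a'_def b'_def rec)
  qed
  moreover have "poly ((pderiv ^^ m) u) 0 = f m \<and> poly ((pderiv ^^ m) u) 1 = g m" if "m < r" for m
  proof -
    have "(pderiv ^^ m) u = (pderiv ^^ Suc m) v + smult (- l h) ((pderiv ^^ m) v)"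
      by (simp only: u_def higher_pderiv_add higher_pderiv_smult funpow_Suc_right o_def)
    then show ?thesis using v[rule_format, of m] v[rule_format, of "Suc m"] that
      by (simp add: rec)
  qed
  ultimately show ?case by blast
qed

lemma diagonal_steering:
  fixes l :: "'k \<Rightarrow> 'a::field_char_0"
  assumes "finite K" and "inj_on l K"
  obtains u \<alpha> where "\<And>k. k \<in> K \<Longrightarrow> pderiv (\<alpha> k) = smult (l k) (\<alpha> k) + u"
    and "\<And>k. k \<in> K \<Longrightarrow> poly (\<alpha> k) 0 = a k" and "\<And>k. k \<in> K \<Longrightarrow> poly (\<alpha> k) 1 = b k"
  using diagonal_steering_jets[OF assms, of a b 0] by auto

section \<open>Trajectories: an obstruction and a supply\<close>

text \<open>Trajectories may fail to be differentiable at finitely many instants; the interval is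
  split at one exceptional point at a time, and continuity joins the pieces.\<close>

lemma eq_endpoints_if_derivative_zero_except_finite:
  fixes f :: "real \<Rightarrow> real"
  assumes "finite F" and "a \<le> b" and "continuous_on {a..b} f"
    and "\<And>t. t \<in> {a<..<b} - F \<Longrightarrow> (f has_real_derivative 0) (at t)"
  shows "f a = f b"
  using assms
proof (induction F arbitrary: a b rule: finite_induct)
  case empty
  show ?case
  proof (cases "a < b")
    case True
    then show ?thesis using DERIV_isconst2[of a b f b] empty by auto
  qed (use empty in auto)
next
  case (insert s F)
  show ?case
  proof (cases "s \<in> {a<..<b}")
    case True
    have "f a = f s"
      by (rule insert.IH) (use True insert.prems in \<open>auto intro: continuous_on_subset\<close>)
    moreover have "f s = f b"
      by (rule insert.IH) (use True insert.prems in \<open>auto intro: continuous_on_subset\<close>)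
    ultimately show ?thesis by simp
  next
    case False
    then show ?thesis using insert.prems by (intro insert.IH) auto
  qed
qed

text \<open>Easy half of the Hautus test: \<open>y = w \<bullet> x\<close> obeys
  \<open>y' = l y\<close> whatever the input, so it stays 0 when started at 0, and the state
  \<open>w\<close> is out of reach.\<close>

lemma not_controllable_if_left_eigenvector:
  fixes w :: "real vec"
  assumes A: "A \<in> carrier_mat n n" and B: "B \<in> carrier_mat n m" and w: "w \<in> carrier_vec n"
    and nz: "w \<noteq> 0\<^sub>v n" and ev: "A\<^sup>T *\<^sub>v w = l \<cdot>\<^sub>v w" and B0: "B\<^sup>T *\<^sub>v w = 0\<^sub>v m"
  shows "\<not> controllable A B"
proof
  assume "controllable A B"
  then obtain T u x where T: "T > 0" and tr: "is_trajectory A B T u x"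
    and x0: "x 0 = 0\<^sub>v n" and xT: "x T = w"
    using A w unfolding controllable_def by (metis carrier_matD(1) zero_carrier_vec)
  have u: "u t \<in> carrier_vec m" and x: "x t \<in> carrier_vec n" if "t \<in> {0..T}" for t
    using tr A B that by (auto simp: is_trajectory_def)
  have cont: "continuous_on {0..T} (\<lambda>t. x t $ r)" if "r < n" for r
    using tr A that by (auto simp: is_trajectory_def)
  obtain F where F: "finite F" and der: "\<And>t r. t \<in> {0..T} - F \<Longrightarrow> r < n \<Longrightarrow>
      ((\<lambda>s. x s $ r) has_real_derivative (A *\<^sub>v x t + B *\<^sub>v u t) $ r) (at t within {0..T})"
    using tr A by (auto simp: is_trajectory_def)
  define y where "y t = (\<Sum>r<n. w $ r * x t $ r)" for t
  have y_eq: "y t = w \<bullet> x t" if "t \<in> {0..T}" for t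
    using x[OF that] by (simp add: y_def scalar_prod_def atLeast0LessThan)
  have y_der: "(y has_real_derivative l * y t) (at t)" if t: "t \<in> {0<..<T} - F" for t
  proof -
    have t': "t \<in> {0..T}" "t \<in> {0..T} - F" using t by auto
    have "(y has_real_derivative (\<Sum>r<n. w $ r * (A *\<^sub>v x t + B *\<^sub>v u t) $ r)) (at t within {0..T})"
      unfolding y_def using t' by (intro DERIV_sum DERIV_cmult der) auto
    also have "(\<Sum>r<n. w $ r * (A *\<^sub>v x t + B *\<^sub>v u t) $ r) = w \<bullet> (A *\<^sub>v x t + B *\<^sub>v u t)"
      using A B by (simp add: scalar_prod_def atLeast0LessThan)
    also have "\<dots> = w \<bullet> (A *\<^sub>v x t) + w \<bullet> (B *\<^sub>v u t)"
      using A B w by (intro scalar_prod_add_distrib[where n = n]) (auto intro: mult_mat_vec_carrier x u t')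
    also have "w \<bullet> (A *\<^sub>v x t) = (A\<^sup>T *\<^sub>v w) \<bullet> x t"
      using transpose_vec_mult_scalar[OF A x[OF t'(1)] w] by simp
    also have "\<dots> = l * y t" using w x[OF t'(1)] by (simp add: ev y_eq[OF t'(1)])
    also have "w \<bullet> (B *\<^sub>v u t) = (B\<^sup>T *\<^sub>v w) \<bullet> u t"
      using transpose_vec_mult_scalar[OF B u[OF t'(1)] w] by simp
    also have "\<dots> = 0" using u[OF t'(1)] by (simp add: B0)
    finally show ?thesis using t by (simp add: at_within_Icc_at)
  qed
  \<comment> \<open>Multiplication by the integrating factor makes the derivative vanish off
    \<open>F\<close>.\<close>
  define z where "z t = exp (- l * t) * y t" for t
  have "z 0 = z T"
  proof (rule eq_endpoints_if_derivative_zero_except_finite[OF F, where f = z])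
    show "continuous_on {0..T} z"
      unfolding z_def y_def by (intro continuous_intros cont) simp
    show "(z has_real_derivative 0) (at t)" if "t \<in> {0<..<T} - F" for t
    proof -
      have "(z has_real_derivative exp (- l * t) * (l * y t) + (exp (- l * t) * (- l)) * y t) (at t)"
        unfolding z_def
        by (rule DERIV_mult'[OF _ y_der[OF that]]) (auto intro!: derivative_eq_intros)
      then show ?thesis by (simp add: algebra_simps)
    qed
  qed (use T in simp)
  moreover have "z 0 = 0" using x0 by (simp add: z_def y_def)
  ultimately have "w \<bullet> w = 0" using y_eq[of T] T xT by (simp add: z_def)
  then have "w = 0\<^sub>v n"
    using conjugate_square_eq_0_vec[OF w] by simp
  then show False using nz by simp
qed

text \<open>Polynomials meet all regularity conditions with empty exceptional sets, which leaves
  only the differential equation to check.\<close>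

lemma is_trajectory_poly:
  assumes "A \<in> carrier_mat n n" and "B \<in> carrier_mat n m"
    and "\<And>t r. r < n \<Longrightarrow> poly (pderiv (X r)) t =
      (A *\<^sub>v vec n (\<lambda>r. poly (X r) t) + B *\<^sub>v vec m (\<lambda>c. poly (U c) t)) $ r"
  shows "is_trajectory A B T (\<lambda>t. vec m (\<lambda>c. poly (U c) t)) (\<lambda>t. vec n (\<lambda>r. poly (X r) t))"
proof -
  have pc: "piecewise_continuous 0 T (\<lambda>t. vec m (\<lambda>c. poly (U c) t) $ c)" if "c < m" for c
  proof -
    have "(poly (U c) \<longlongrightarrow> poly (U c) t) (at t within S)" for t S
      by (rule tendsto_intros) (rule tendsto_ident_at)
    then show ?thesis using that
      unfolding piecewise_continuous_def by (auto intro!: exI[of _ "{}"] simp: continuous_within)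
  qed
  have "((\<lambda>s. vec n (\<lambda>r. poly (X r) s) $ r) has_real_derivative
      (A *\<^sub>v vec n (\<lambda>r. poly (X r) t) + B *\<^sub>v vec m (\<lambda>c. poly (U c) t)) $ r) (at t within S)"
    if "r < n" for r t S
    using that by (simp flip: assms(3) add: poly_DERIV has_field_derivative_at_within)
  then show ?thesis
    using assms(1,2) pc unfolding is_trajectory_def
    by (auto intro!: exI[of _ "{}"] continuous_intros)
qed

section \<open>The matrices of the cycle\<close>

lemma cycle_graph_edge_iff:
  assumes "n \<ge> 3" and "r < n" and "c < n"
  shows "{r + 1, c + 1} \<in> cycle_graph n \<longleftrightarrow>
    c = (if r + 1 = n then 0 else r + 1) \<or> c = (if r = 0 then n - 1 else r - 1)"
  using assms unfolding cycle_graph_def by (auto simp: doubleton_eq_iff)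

text \<open>Reading a vector as an \<open>n\<close>-periodic function on the integers hides the
  wrap-around: the matrix becomes the sum of the two unit shifts.\<close>

lemma adjacency_cycle_mult_vec:
  fixes f :: "int \<Rightarrow> real"
  assumes n: "n \<ge> 3" and per: "\<And>m. f (m + int n) = f m" and r: "r < n"
  shows "(adjacency_matrix n (cycle_graph n) *\<^sub>v vec n (\<lambda>r. f (int r))) $ r =
    f (int r + 1) + f (int r - 1)"
proof -
  let ?s = "if r + 1 = n then 0 else r + 1" and ?p = "if r = 0 then n - 1 else r - 1"
  have "(adjacency_matrix n (cycle_graph n) *\<^sub>v vec n (\<lambda>r. f (int r))) $ r =
      (\<Sum>c<n. (if {r + 1, c + 1} \<in> cycle_graph n then 1 else 0) * f (int c))"
    using r by (simp add: adjacency_matrix_def mult_mat_vec_def scalar_prod_def atLeast0LessThan)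
  also have "\<dots> = (\<Sum>c<n. if c \<in> {?s, ?p} then f (int c) else 0)"
    using cycle_graph_edge_iff[OF n r] by (intro sum.cong) auto
  also have "\<dots> = (\<Sum>c\<in>{?s, ?p}. f (int c))"
    using n r by (intro sum.mono_neutral_cong_right) auto
  \<comment> \<open>As \<open>n \<ge> 3\<close>, the cyclic successor and predecessor of
    \<open>r\<close> are distinct.\<close>
  also have "\<dots> = f (int ?s) + f (int ?p)"
    using n r by simp
  also have "f (int ?s) = f (int r + 1)"
    using per[of 0] by (auto simp: algebra_simps)
  also have "f (int ?p) = f (int r - 1)"
    using per[of "-1"] n r by (auto simp: of_nat_diff algebra_simps)
  finally show ?thesis .
qed

lemma transpose_adjacency_matrix: "(adjacency_matrix n E)\<^sup>T = adjacency_matrix n E"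
  by (auto simp: adjacency_matrix_def insert_commute)

lemma input_matrix_pair:
  assumes "i < j"
  shows "input_matrix n {i, j} = mat n 2 (\<lambda>(r, c). if r = (if c = 0 then i - 1 else j - 1) then 1 else 0)"
proof -
  have "sorted_list_of_set {i, j} = [i, j]"
    using assms sorted_list_of_set_unique[of "{i, j}" "[i, j]"] by (auto simp: less_imp_neq)
  then have "input_matrix n {i, j} = mat_of_cols n [unit_vec n (i - 1), unit_vec n (j - 1)]"
    by (simp add: input_matrix_def)
  then show ?thesis
    by (intro eq_matI) (auto simp: mat_of_cols_def unit_vec_def less_2_cases_iff)
qed

section \<open>Sampled cosine waves\<close>

text \<open>For \<open>m \<noteq> 0\<close>, multiplication by \<open>2 * sin (\<theta> / 2)\<close>
  makes the sum telescope to 0 over a full period; the bound on \<open>m\<close> keeps this factor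
  nonzero.\<close>

lemma sum_cos_full_period:
  fixes m :: int
  assumes "\<bar>m\<bar> < int n"
  shows "(\<Sum>k<n. cos (2 * pi * real k / real n * real_of_int m)) = (if m = 0 then real n else 0)"
proof (cases "m = 0")
  case False
  define \<theta> where "\<theta> = 2 * pi * real_of_int m / real n"
  have n: "n > 0" using assms by auto
  have tel: "2 * sin (\<theta> / 2) * (\<Sum>k<N. cos (real k * \<theta>)) = sin (real N * \<theta> - \<theta> / 2) + sin (\<theta> / 2)" for N
  proof (induction N)
    case (Suc N)
    have e: "real (Suc N) * \<theta> - \<theta> / 2 = real N * \<theta> + \<theta> / 2" by (simp add: field_simps)
    have "2 * sin (\<theta> / 2) * cos (real N * \<theta>) =
        sin (real N * \<theta> + \<theta> / 2) - sin (real N * \<theta> - \<theta> / 2)"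
      unfolding sin_add sin_diff by simp
    then show ?case using Suc.IH unfolding e sum.lessThan_Suc distrib_left by linarith
  qed simp
  have "real n * \<theta> = 2 * pi * real_of_int m" using n by (simp add: \<theta>_def)
  then have "sin (real n * \<theta> - \<theta> / 2) = - sin (\<theta> / 2)"
    by (simp add: sin_diff sin_int_2pin cos_int_2pin)
  moreover have "sin (\<theta> / 2) \<noteq> 0"
  proof
    assume "sin (\<theta> / 2) = 0"
    then obtain e :: int where "\<theta> / 2 = of_int e * pi" unfolding sin_zero_iff_int2 by blast
    then have "real_of_int m = real_of_int (e * int n)" using n by (simp add: \<theta>_def field_simps)
    then have "m = e * int n" by linarith
    then have "int n dvd m" by simp
    then show False using False assms zdvd_not_zless[of "\<bar>m\<bar>" "int n"] by auto
  qed
  ultimately have "(\<Sum>k<n. cos (real k * \<theta>)) = 0" using tel[of n] by simp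
  then show ?thesis using False by (simp add: \<theta>_def algebra_simps)
qed simp

lemma cos_mode_reflect:
  assumes "k < n"
  shows "cos (2 * pi * real (min k (n - k)) / real n * real_of_int m) = cos (2 * pi * real k / real n * real_of_int m)"
proof (cases "k \<le> n - k")
  case False
  have "2 * pi * real (n - k) / real n * real_of_int m =
      2 * pi * real_of_int m - 2 * pi * real k / real n * real_of_int m"
    using assms by (simp add: field_simps of_nat_diff)
  then have "cos (2 * pi * real (n - k) / real n * real_of_int m) = cos (2 * pi * real k / real n * real_of_int m)"
    by (metis add_0 cos_diff cos_int_2pin diff_zero mult_1 mult_zero_left sin_int_2pin add.right_neutral)
  then show ?thesis using False by simp
qed simp

text \<open>These frequencies lie in the interval from 0 to \<open>pi\<close>, where cosine is
  injective. Distinct eigenvalues are what \<open>diagonal_steering\<close> requires.\<close>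

lemma inj_on_cos_mode:
  assumes "n > 0"
  shows "inj_on (\<lambda>k. 2 * cos (2 * pi * real k / real n)) {..n div 2}"
proof (rule inj_onI)
  have bd: "0 \<le> 2 * pi * real k / real n \<and> 2 * pi * real k / real n \<le> pi" if "k \<le> n div 2" for k
  proof -
    have "2 * real k \<le> real n" using that by linarith
    then have "pi * (2 * real k) \<le> pi * real n" by (intro mult_left_mono) simp_all
    then have "2 * pi * real k \<le> pi * real n" by (simp add: mult_ac)
    then show ?thesis using assms by (simp add: pos_divide_le_eq)
  qed
  fix k l assume "k \<in> {..n div 2}" "l \<in> {..n div 2}"
    and "2 * cos (2 * pi * real k / real n) = 2 * cos (2 * pi * real l / real n)"
  then have "2 * pi * real k / real n = 2 * pi * real l / real n"
    using bd[of k] bd[of l] by - (rule cos_inj_pi, simp_all)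
  then show "k = l" using assms by simp
qed

text \<open>In general two phases span all waves of frequency \<open>\<theta>\<close>. If they are
  dependent, the assumption makes the sine waves vanish at all integers, and one phase
  suffices.\<close>

lemma cos_shift_combination:
  fixes \<theta> :: real and p q w :: int
  assumes "sin (\<theta> * of_int (q - p)) = 0 \<Longrightarrow> (\<And>m::int. sin (\<theta> * of_int m) = 0)"
  shows "\<exists>a b. \<forall>v::int. cos (\<theta> * of_int (v - w)) = a * cos (\<theta> * of_int (v - p)) + b * cos (\<theta> * of_int (v - q))"
proof (cases "sin (\<theta> * of_int (q - p)) = 0")
  case True
  have "cos (\<theta> * of_int (v - w)) = cos (\<theta> * of_int (p - w)) * cos (\<theta> * of_int (v - p))
      + 0 * cos (\<theta> * of_int (v - q))" for v
  proof -
    have "\<theta> * of_int (v - w) = \<theta> * of_int (p - w) + \<theta> * of_int (v - p)"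
      by (simp add: algebra_simps)
    then have "cos (\<theta> * of_int (v - w)) = cos (\<theta> * of_int (p - w)) * cos (\<theta> * of_int (v - p)) -
        sin (\<theta> * of_int (p - w)) * sin (\<theta> * of_int (v - p))"
      by (simp only: cos_add)
    then show ?thesis using assms[OF True, of "p - w"] by simp
  qed
  then show ?thesis by blast
next
  case False
  define s where "s = sin (\<theta> * of_int (q - p))"
  have s: "s \<noteq> 0" using False by (simp add: s_def)
  \<comment> \<open>Up to the factor \<open>s\<close>, this interpolates in \<open>w\<close> between
    \<open>w = p\<close> and \<open>w = q\<close>.\<close>
  have id: "s * cos (\<theta> * of_int (v - w)) = sin (\<theta> * of_int (q - w)) * cos (\<theta> * of_int (v - p))
      - sin (\<theta> * of_int (p - w)) * cos (\<theta> * of_int (v - q))" for v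
    unfolding s_def of_int_diff right_diff_distrib sin_diff cos_diff by (simp add: algebra_simps)
  have "cos (\<theta> * of_int (v - w)) = sin (\<theta> * of_int (q - w)) / s * cos (\<theta> * of_int (v - p))
      + (- sin (\<theta> * of_int (p - w)) / s) * cos (\<theta> * of_int (v - q))" for v
  proof -
    have "cos (\<theta> * of_int (v - w)) = s * cos (\<theta> * of_int (v - w)) / s" using s by simp
    then show ?thesis unfolding id by (simp add: diff_divide_distrib)
  qed
  then show ?thesis by blast
qed

section \<open>Distances in the cycle\<close>

text \<open>Every edge moves by 1 or -1 modulo \<open>n\<close>; \<open>s\<close> is the net signed
  movement of the walk.\<close>

lemma cycle_walk_displacement:
  assumes "(v, w) \<in> {(a, b). {a, b} \<in> cycle_graph n} ^^ l"
  shows "\<exists>s::int. \<bar>s\<bar> \<le> int l \<and> int n dvd int w - int v - s"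
  using assms
proof (induction l arbitrary: w)
  case 0
  then show ?case by (intro exI[of _ 0]) auto
next
  case (Suc l)
  then obtain x where x: "(v, x) \<in> {(a, b). {a, b} \<in> cycle_graph n} ^^ l"
    and e: "{x, w} \<in> cycle_graph n" by auto
  obtain s where s: "\<bar>s\<bar> \<le> int l" "int n dvd int x - int v - s" using Suc.IH[OF x] by blast
  have "w = x + 1 \<or> x = w + 1 \<or> (x = 1 \<and> w = n) \<or> (x = n \<and> w = 1)"
    using e by (auto simp: cycle_graph_def doubleton_eq_iff)
  \<comment> \<open>Crossing from 1 to \<open>n\<close> counts as \<open>d = -1\<close>, and the
    reverse as \<open>d = 1\<close>.\<close>
  then have "\<exists>d::int. \<bar>d\<bar> \<le> 1 \<and> int n dvd int w - int x - d"
    by (elim disjE) (auto intro: exI[of _ 1] exI[of _ "-1"])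
  then obtain d :: int where d: "\<bar>d\<bar> \<le> 1" "int n dvd int w - int x - d" by blast
  have "int w - int v - (s + d) = (int x - int v - s) + (int w - int x - d)" by simp
  then have "int n dvd int w - int v - (s + d)" using s(2) d(2) by (metis dvd_add)
  then show ?case using s(1) d(1) by (intro exI[of _ "s + d"]) auto
qed

lemma cycle_walk_up:
  assumes "1 \<le> v" and "v \<le> w" and "w \<le> n"
  shows "(v, w) \<in> {(a, b). {a, b} \<in> cycle_graph n} ^^ (w - v)"
  using assms(2,3,1)
proof (induction w rule: dec_induct)
  case (step w)
  have "{w, Suc w} \<in> cycle_graph n" using step by (auto simp: cycle_graph_def)
  then show ?case using step by (auto simp: Suc_diff_le)
qed simp

lemma relpow_sym:
  assumes "sym r" and "(x, y) \<in> r ^^ l"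
  shows "(y, x) \<in> r ^^ l"
  using assms(2)
proof (induction l arbitrary: y)
  case (Suc l)
  then obtain z where "(x, z) \<in> r ^^ l" "(z, y) \<in> r" by auto
  then show ?case using Suc.IH assms(1) by (meson relpow_Suc_I2 symD)
qed simp

lemma graph_dist_commute: "graph_dist E v w = graph_dist E w v"
proof -
  have "sym {(a, b). {a, b} \<in> E}" by (auto simp: sym_def insert_commute)
  then show ?thesis unfolding graph_dist_def by (metis relpow_sym)
qed

text \<open>The two arcs give the upper bound, the displacement of a walk the lower bound.\<close>

lemma graph_dist_cycle_graph:
  assumes "1 \<le> i" and "i < j" and "j \<le> n"
  shows "graph_dist (cycle_graph n) i j = min (j - i) (n - (j - i))"
proof -
  let ?R = "{(a, b). {a, b} \<in> cycle_graph n}"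
  have sym: "sym ?R" by (auto simp: sym_def insert_commute)
  have "(i, 1) \<in> ?R ^^ (i - 1)" using relpow_sym[OF sym cycle_walk_up[of 1 i n]] assms by auto
  moreover have "(1, n) \<in> ?R ^^ 1" by (simp add: cycle_graph_def)
  moreover have "(n, j) \<in> ?R ^^ (n - j)" using relpow_sym[OF sym cycle_walk_up[of j n n]] assms by auto
  ultimately have "(i, j) \<in> ?R ^^ (i - 1 + 1 + (n - j))"
    unfolding relpow_add by blast
  moreover have "i - 1 + 1 + (n - j) = n - (j - i)" using assms by simp
  ultimately have *: "(i, j) \<in> ?R ^^ (n - (j - i))" by (simp only:)
  have "(i, j) \<in> ?R ^^ min (j - i) (n - (j - i))"
    using * cycle_walk_up[of i j n] assms by (simp add: min_def)
  moreover have "min (j - i) (n - (j - i)) \<le> l" if walk: "(i, j) \<in> ?R ^^ l" for l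
  proof -
    obtain s :: int where s: "\<bar>s\<bar> \<le> int l" "int n dvd int j - int i - s"
      using cycle_walk_displacement[OF walk] by blast
    then obtain c where c: "int j - int i - s = int n * c" by (elim dvdE)
    \<comment> \<open>The number \<open>c\<close> counts turns around the cycle: without a turn
      \<open>s = j - i\<close>, otherwise \<bar>s\<bar> is at least
      \<open>n - (j - i)\<close>.\<close>
    consider "c = 0" | "c \<ge> 1" | "c \<le> - 1" by linarith
    then show ?thesis
    proof cases
      case 1
      then show ?thesis using c s(1) assms by simp
    next
      case 2
      then have "int n * 1 \<le> int n * c" by (intro mult_left_mono) simp_all
      then show ?thesis using c s(1) assms by linarith
    next
      case 3
      then have "int n * c \<le> int n * (- 1)" by (intro mult_left_mono) simp_all
      then show ?thesis using c s(1) assms by linarith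
    qed
  qed
  ultimately show ?thesis unfolding graph_dist_def by (rule Least_equality)
qed

text \<open>Modulo \<open>n\<close>, the two numbers \<open>2 * (n - d)\<close> and
  \<open>2 * d\<close> are opposite. Hence it does not matter which arc is the shorter one.\<close>

lemma gcd_double_reflect:
  fixes d n :: nat
  assumes "d \<le> n"
  shows "gcd (2 * (n - d)) n = gcd (2 * d) n"
proof -
  have *: "gcd (2 * e) n dvd gcd (2 * (n - e)) n" for e
    unfolding diff_mult_distrib2 by (intro gcd_greatest dvd_diff_nat) simp_all
  show ?thesis using *[of d] *[of "n - d"] assms by (intro dvd_antisym) simp_all
qed

lemma gcd_graph_dist_cycle_graph:
  assumes "1 \<le> i" and "i < j" and "j \<le> n"
  shows "gcd (2 * graph_dist (cycle_graph n) i j) n = gcd (2 * (j - i)) n"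
  using graph_dist_cycle_graph[OF assms] gcd_double_reflect[of "j - i" n] assms
  by (simp add: min_def)

section \<open>An uncontrollable mode for gcd at least 3\<close>

lemma not_controllable_cycle:
  assumes n: "n \<ge> 3" and ij: "1 \<le> i" "i < j" "j \<le> n"
    and g: "gcd (2 * (j - i)) n \<notin> {1, 2}"
  shows "\<not> controllable (adjacency_matrix n (cycle_graph n)) (input_matrix n {i, j})"
proof -
  define g where "g = gcd (2 * (j - i)) n"
  have "g \<noteq> 0" using n by (simp add: g_def)
  then have g3: "g \<ge> 3" using g unfolding g_def[symmetric] by auto
  define \<theta> where "\<theta> = 2 * pi / real g"
  define f where "f m = sin (\<theta> * of_int (m - int (i - 1)))" for m
  obtain c where c: "n = g * c" unfolding g_def by (metis dvdE gcd_dvd2)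
  obtain e where e: "2 * (j - i) = g * e" unfolding g_def by (metis dvdE gcd_dvd1)
  have per: "f (m + int n) = f m" for m
  proof -
    have "\<theta> * of_int (m + int n - int (i - 1)) = \<theta> * of_int (m - int (i - 1)) + 2 * pi * of_int (int c)"
      using g3 by (simp add: \<theta>_def c field_simps)
    then show ?thesis unfolding f_def
      using sin_int_2pin[of "int c"] cos_int_2pin[of "int c"] by (simp add: sin_add)
  qed
  have fi: "f (int (i - 1)) = 0" by (simp add: f_def)
  have fj: "f (int (j - 1)) = 0"
  proof -
    \<comment> \<open>As \<open>g\<close> divides \<open>2 * (j - i)\<close>, the phases at the two
      vertices differ by a multiple of \<open>pi\<close>.\<close>
    have "2 * (real j - real i) = real g * real e" using arg_cong[OF e, of real] ij by (simp add: of_nat_diff)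
    then have "\<theta> * of_int (int (j - 1) - int (i - 1)) = real e * pi"
      using g3 ij by (simp add: \<theta>_def field_simps of_nat_diff)
    then show ?thesis unfolding f_def by (simp only: sin_npi)
  qed
  define w where "w = vec n (\<lambda>r. f (int r))"
  have w: "w \<in> carrier_vec n" by (simp add: w_def)
  have \<theta>: "0 < \<theta>" "\<theta> < pi" using g3 by (simp_all add: \<theta>_def field_simps)
  \<comment> \<open>Index \<open>i\<close> belongs to vertex \<open>i + 1\<close>, the one right
    after \<open>i\<close>; it exists because \<open>i < j \<le> n\<close>.\<close>
  have "w $ i = sin \<theta>" using ij by (simp add: w_def f_def of_nat_diff)
  then have nz: "w \<noteq> 0\<^sub>v n" using sin_gt_zero[OF \<theta>] ij by auto
  have step: "f (m + 1) + f (m - 1) = 2 * cos \<theta> * f m" for m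
  proof -
    have "\<theta> * of_int (m + 1 - int (i - 1)) = \<theta> * of_int (m - int (i - 1)) + \<theta>"
      "\<theta> * of_int (m - 1 - int (i - 1)) = \<theta> * of_int (m - int (i - 1)) - \<theta>"
      by (simp_all add: algebra_simps)
    then show ?thesis unfolding f_def by (simp only: sin_add sin_diff) simp
  qed
  show ?thesis
  proof (rule not_controllable_if_left_eigenvector[OF _ _ w nz])
    show "adjacency_matrix n (cycle_graph n) \<in> carrier_mat n n" by (simp add: adjacency_matrix_def)
    show B: "input_matrix n {i, j} \<in> carrier_mat n 2" using ij by (simp add: input_matrix_pair)
    show "(adjacency_matrix n (cycle_graph n))\<^sup>T *\<^sub>v w = (2 * cos \<theta>) \<cdot>\<^sub>v w"
    proof (rule eq_vecI)
      fix r assume "r < dim_vec ((2 * cos \<theta>) \<cdot>\<^sub>v w)"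
      then have "r < n" using w by simp
      then show "((adjacency_matrix n (cycle_graph n))\<^sup>T *\<^sub>v w) $ r = ((2 * cos \<theta>) \<cdot>\<^sub>v w) $ r"
        unfolding transpose_adjacency_matrix w_def using adjacency_cycle_mult_vec[of n f r] n per step by simp
    qed (use w in \<open>simp add: adjacency_matrix_def\<close>)
    show "(input_matrix n {i, j})\<^sup>T *\<^sub>v w = 0\<^sub>v 2"
    proof (rule eq_vecI)
      fix c :: nat assume "c < dim_vec (0\<^sub>v 2 :: real vec)"
      then have c: "c < 2" by simp
      let ?v = "if c = 0 then i - 1 else j - 1"
      have "((input_matrix n {i, j})\<^sup>T *\<^sub>v w) $ c = (\<Sum>r<n. (if r = ?v then 1 else 0) * f (int r))"
        using ij c w by (auto simp: input_matrix_pair w_def scalar_prod_def atLeast0LessThan intro!: sum.cong)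
      also have "\<dots> = (\<Sum>r<n. if r = ?v then f (int r) else 0)" by (intro sum.cong) auto
      also have "\<dots> = 0" using ij fi fj by simp
      finally show "((input_matrix n {i, j})\<^sup>T *\<^sub>v w) $ c = 0\<^sub>v 2 $ c" using c by simp
    qed (use ij in \<open>simp add: input_matrix_pair\<close>)
  qed
qed

section \<open>Controllability for gcd 1 or 2\<close>

text \<open>Up to the factor \<open>n\<close>, this is the Fourier expansion of the unit vector at
  \<open>s\<close>, so an input at \<open>s\<close> enters all modes alike.\<close>

lemma sum_cos_modes_eq_delta:
  assumes "r < n" and "s < n"
  shows "(\<Sum>k<n. cos (2 * pi * real (min k (n - k)) / real n * of_int (int r - int s))) =
    (if r = s then real n else 0)"
proof -
  have "(\<Sum>k<n. cos (2 * pi * real (min k (n - k)) / real n * of_int (int r - int s))) =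
      (\<Sum>k<n. cos (2 * pi * real k / real n * of_int (int r - int s)))"
    by (intro sum.cong refl cos_mode_reflect) simp
  also have "\<dots> = (if int r - int s = 0 then real n else 0)"
    by (rule sum_cos_full_period) (use assms in linarith)
  finally show ?thesis by simp
qed

text \<open>
  The index \<open>k\<close> is folded to \<open>min k (n - k)\<close> because \<open>k\<close> and \<open>n - k\<close> give the same wave: one
  coefficient per distinct eigenvalue.
\<close>

lemma cos_mode_coordinates:
  fixes x :: "nat \<Rightarrow> real" and i j n :: nat
  defines "c \<equiv> \<lambda>k (m::int). cos (2 * pi * real k / real n * of_int m)"
  assumes ij: "i < j" "j < n" and g: "gcd (2 * (j - i)) n \<in> {1, 2}"
  shows "\<exists>a b. \<forall>r<n. x r = (\<Sum>k<n. c (min k (n - k)) (int r - int i) / n * a (min k (n - k)) +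
    c (min k (n - k)) (int r - int j) / n * b (min k (n - k)))"
proof -
  let ?\<rho> = "\<lambda>k. min k (n - k)"
  \<comment> \<open>The gcd hypothesis enters here: a zero means that \<open>n\<close> divides
    \<open>2 * k * (j - i)\<close>, hence \<open>2 * k\<close>, so the frequency is a multiple of
    \<open>pi\<close>.\<close>
  have vanish: "sin (2 * pi * real k / real n * of_int m) = 0"
    if zero: "sin (2 * pi * real k / real n * of_int (int j - int i)) = 0" for k and m :: int
  proof -
    obtain e :: int where "2 * pi * real k / real n * of_int (int j - int i) = of_int e * pi"
      using zero unfolding sin_zero_iff_int2 by blast
    then have "pi * (2 * real k * of_int (int j - int i)) = pi * (of_int e * real n)"
      using ij by (simp add: divide_eq_eq mult_ac)
    then have "real_of_int (2 * int k * (int j - int i)) = real_of_int (e * int n)" by simp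
    then have "2 * int k * (int j - int i) = e * int n" by (simp only: of_int_eq_iff)
    then have "int n dvd int (k * (2 * (j - i)))"
      using ij by (simp add: of_nat_diff mult_ac)
    then have "n dvd k * (2 * (j - i))" by (simp only: int_dvd_int_iff)
    then have "n dvd gcd (k * (2 * (j - i))) (k * n)" by (intro gcd_greatest) simp_all
    then have "n dvd k * gcd (2 * (j - i)) n" by (simp only: gcd_mult_distrib_nat)
    moreover have "gcd (2 * (j - i)) n dvd 2" using g by auto
    ultimately have "n dvd k * 2" by (rule dvd_trans[OF _ mult_dvd_mono[OF dvd_refl]])
    then obtain d where "k * 2 = n * d" by (elim dvdE)
    then have d: "real k * 2 = real n * real d" by (metis of_nat_mult of_nat_numeral)
    have "2 * pi * real k / real n * of_int m = pi * of_int m * (real k * 2) / real n" by simp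
    also have "\<dots> = pi * of_int (int d * m)" unfolding d using ij by simp
    finally show ?thesis by (simp only: sin_npi_int)
  qed
  have "\<exists>a b. \<forall>v::int. c k (v - int w) = a * c k (v - int i) + b * c k (v - int j)" for k w
    unfolding c_def by (rule cos_shift_combination) (rule vanish)
  then obtain A B where AB: "\<And>k w v. c k (v - int w) = A k w * c k (v - int i) + B k w * c k (v - int j)"
    by metis
  \<comment> \<open>Each unit vector is expanded into waves centred at its own index
    \<open>w\<close>, which are then rewritten by waves centred at \<open>i\<close> and
    \<open>j\<close>. The resulting coefficients do not depend on \<open>r\<close>.\<close>
  have "x r = (\<Sum>k<n. c (?\<rho> k) (int r - int i) / n * (\<Sum>w<n. x w * A (?\<rho> k) w) +
      c (?\<rho> k) (int r - int j) / n * (\<Sum>w<n. x w * B (?\<rho> k) w))" if r: "r < n" for r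
  proof -
    have "x r = (\<Sum>w<n. if w = r then x w else 0)" using r by simp
    also have "\<dots> = (\<Sum>w<n. x w * ((\<Sum>k<n. c (?\<rho> k) (int r - int w)) / n))"
    proof (intro sum.cong refl)
      fix w assume "w \<in> {..<n}"
      then have "(\<Sum>k<n. c (?\<rho> k) (int r - int w)) = (if r = w then real n else 0)"
        unfolding c_def using sum_cos_modes_eq_delta[OF r] by simp
      then show "(if w = r then x w else 0) = x w * ((\<Sum>k<n. c (?\<rho> k) (int r - int w)) / n)"
        using r by simp
    qed
    also have "\<dots> = (\<Sum>w<n. \<Sum>k<n. x w * c (?\<rho> k) (int r - int w) / n)"
      by (simp add: sum_distrib_left sum_divide_distrib)
    also have "\<dots> = (\<Sum>k<n. \<Sum>w<n. x w * c (?\<rho> k) (int r - int w) / n)"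
      by (rule sum.swap)
    also have "\<dots> = (\<Sum>k<n. \<Sum>w<n. c (?\<rho> k) (int r - int i) / n * (x w * A (?\<rho> k) w) +
        c (?\<rho> k) (int r - int j) / n * (x w * B (?\<rho> k) w))"
    proof (intro sum.cong refl)
      fix k w
      show "x w * c (?\<rho> k) (int r - int w) / n = c (?\<rho> k) (int r - int i) / n * (x w * A (?\<rho> k) w) +
          c (?\<rho> k) (int r - int j) / n * (x w * B (?\<rho> k) w)"
        unfolding AB[of "?\<rho> k" "int r" w] by (simp add: distrib_left add_divide_distrib mult_ac)
    qed
    finally show ?thesis by (simp add: sum.distrib sum_distrib_left)
  qed
  then show ?thesis by (intro exI allI impI)
qed

text \<open>The coefficients of the waves centred at each of the two vertices form a diagonal system
  with its own input. Both are steered separately in unit time, and the results are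
  superposed.\<close>

lemma controllable_cycle:
  assumes n: "n \<ge> 3" and ij: "1 \<le> i" "i < j" "j \<le> n"
    and g: "gcd (2 * (j - i)) n \<in> {1, 2}"
  shows "controllable (adjacency_matrix n (cycle_graph n)) (input_matrix n {i, j})"
  unfolding controllable_def
proof (intro ballI)
  let ?A = "adjacency_matrix n (cycle_graph n)" and ?B = "input_matrix n {i, j}"
  have A: "?A \<in> carrier_mat n n" by (simp add: adjacency_matrix_def)
  have B: "?B \<in> carrier_mat n 2" using ij by (simp add: input_matrix_pair)
  fix x0 x1 :: "real vec" assume "x0 \<in> carrier_vec (dim_row ?A)" "x1 \<in> carrier_vec (dim_row ?A)"
  then have x0: "x0 \<in> carrier_vec n" and x1: "x1 \<in> carrier_vec n" using A by auto
  define p where "p = i - 1"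
  define q where "q = j - 1"
  have pq: "p < q" "q < n" using ij by (auto simp: p_def q_def)
  have g': "gcd (2 * (q - p)) n \<in> {1, 2}" using g ij by (simp add: p_def q_def)
  define c where "c k m = cos (2 * pi * real k / real n * of_int m)" for k and m :: int
  define \<rho> where "\<rho> k = min k (n - k)" for k
  define l where "l k = 2 * cos (2 * pi * real k / real n)" for k
  have \<rho>: "\<rho> k \<in> {..n div 2}" for k by (auto simp: \<rho>_def)
  have inj: "inj_on l {..n div 2}" using inj_on_cos_mode[of n] n by (simp add: l_def[abs_def])
  have coords: "\<exists>a b. \<forall>r<n. x r = (\<Sum>k<n. c (\<rho> k) (int r - int p) / n * a (\<rho> k) +
      c (\<rho> k) (int r - int q) / n * b (\<rho> k))" for x
    unfolding c_def \<rho>_def by (rule cos_mode_coordinates[OF pq g'])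
  obtain a0 b0 where ab0: "\<forall>r<n. x0 $ r = (\<Sum>k<n. c (\<rho> k) (int r - int p) / n * a0 (\<rho> k) +
      c (\<rho> k) (int r - int q) / n * b0 (\<rho> k))" using coords[of "($) x0"] by blast
  obtain a1 b1 where ab1: "\<forall>r<n. x1 $ r = (\<Sum>k<n. c (\<rho> k) (int r - int p) / n * a1 (\<rho> k) +
      c (\<rho> k) (int r - int q) / n * b1 (\<rho> k))" using coords[of "($) x1"] by blast
  obtain u \<alpha> where \<alpha>: "\<And>k. k \<in> {..n div 2} \<Longrightarrow> pderiv (\<alpha> k) = smult (l k) (\<alpha> k) + u"
    "\<And>k. k \<in> {..n div 2} \<Longrightarrow> poly (\<alpha> k) 0 = a0 k" "\<And>k. k \<in> {..n div 2} \<Longrightarrow> poly (\<alpha> k) 1 = a1 k"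
    using diagonal_steering[OF finite_atMost inj] by metis
  obtain v \<beta> where \<beta>: "\<And>k. k \<in> {..n div 2} \<Longrightarrow> pderiv (\<beta> k) = smult (l k) (\<beta> k) + v"
    "\<And>k. k \<in> {..n div 2} \<Longrightarrow> poly (\<beta> k) 0 = b0 k" "\<And>k. k \<in> {..n div 2} \<Longrightarrow> poly (\<beta> k) 1 = b1 k"
    using diagonal_steering[OF finite_atMost inj] by metis
  define X where "X r = (\<Sum>k<n. smult (c (\<rho> k) (int r - int p) / n) (\<alpha> (\<rho> k)) +
      smult (c (\<rho> k) (int r - int q) / n) (\<beta> (\<rho> k)))" for r
  define U where "U s = (if s = (0::nat) then u else v)" for s
  \<comment> \<open>The state at time \<open>t\<close>, extended \<open>n\<close>-periodically to
    the integers.\<close>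
  define f where "f t m = (\<Sum>k<n. c (\<rho> k) (m - int p) / n * poly (\<alpha> (\<rho> k)) t +
      c (\<rho> k) (m - int q) / n * poly (\<beta> (\<rho> k)) t)" for t m
  have X: "poly (X r) t = f t (int r)" for r t
    by (simp add: X_def f_def poly_sum)
  have c_per: "c k (m + int n) = c k m" for k m
  proof -
    have "2 * pi * real k / real n * of_int (m + int n) =
        2 * pi * real k / real n * of_int m + 2 * pi * of_int (int k)"
      using n by (simp add: field_simps)
    then show ?thesis unfolding c_def by (simp only: cos_add sin_int_2pin cos_int_2pin)
  qed
  have c_step: "c k (m + 1) + c k (m - 1) = l k * c k m" for k m
    unfolding c_def l_def of_int_add of_int_diff of_int_1 distrib_left right_diff_distrib mult_1_right
      cos_add cos_diff by simp
  have c_sum: "(\<Sum>k<n. c (\<rho> k) (int r - int s)) = (if r = s then real n else 0)" if "r < n" "s < n" for r s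
    unfolding c_def \<rho>_def using that by (rule sum_cos_modes_eq_delta)
  have f_per: "f t (m + int n) = f t m" for t m
  proof -
    have "m + int n - int s = (m - int s) + int n" for s by simp
    then show ?thesis by (simp only: f_def c_per)
  qed
  have f_step: "f t (m + 1) + f t (m - 1) = (\<Sum>k<n. l (\<rho> k) * (c (\<rho> k) (m - int p) / n * poly (\<alpha> (\<rho> k)) t +
      c (\<rho> k) (m - int q) / n * poly (\<beta> (\<rho> k)) t))" for t m
  proof -
    have "l k * c k (m - int s) = c k (m + 1 - int s) + c k (m - 1 - int s)" for k s
      using c_step[of k "m - int s"] by (simp add: algebra_simps)
    then have "l k * (c k (m - int p) / n * y + c k (m - int q) / n * z) =
        (c k (m + 1 - int p) / n * y + c k (m + 1 - int q) / n * z) +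
        (c k (m - 1 - int p) / n * y + c k (m - 1 - int q) / n * z)" for k y z
      by (simp add: distrib_left distrib_right add_divide_distrib flip: mult.assoc times_divide_eq_right[of "l k"])
    then show ?thesis by (simp only: f_def sum.distrib)
  qed
  have traj: "is_trajectory ?A ?B 1 (\<lambda>t. vec 2 (\<lambda>s. poly (U s) t)) (\<lambda>t. vec n (\<lambda>r. poly (X r) t))"
  proof (rule is_trajectory_poly[OF A B])
    fix t r assume r: "r < n"
    have "poly (pderiv (X r)) t =
        (\<Sum>k<n. c (\<rho> k) (int r - int p) / n * (l (\<rho> k) * poly (\<alpha> (\<rho> k)) t + poly u t) +
          c (\<rho> k) (int r - int q) / n * (l (\<rho> k) * poly (\<beta> (\<rho> k)) t + poly v t))"
      unfolding X_def higher_pderiv_sum[of 1, simplified] pderiv_add pderiv_smult \<alpha>(1)[OF \<rho>] \<beta>(1)[OF \<rho>]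
      by (simp add: poly_sum)
    also have "\<dots> = (\<Sum>k<n. l (\<rho> k) * (c (\<rho> k) (int r - int p) / n * poly (\<alpha> (\<rho> k)) t +
        c (\<rho> k) (int r - int q) / n * poly (\<beta> (\<rho> k)) t)) +
        ((\<Sum>k<n. c (\<rho> k) (int r - int p)) / n * poly u t + (\<Sum>k<n. c (\<rho> k) (int r - int q)) / n * poly v t)"
    proof -
      have "C * (m * y + y') + D * (m * z + z') = m * (C * y + D * z) + (C * y' + D * z')"
        for C D m y y' z z' :: real by (simp add: algebra_simps)
      then show ?thesis by (simp only: sum.distrib sum_divide_distrib sum_distrib_right)
    qed
    \<comment> \<open>By \<open>c_sum\<close> the input terms collapse to Kronecker deltas:
      \<open>u\<close> acts only at \<open>p\<close>, \<open>v\<close> only at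
      \<open>q\<close>.\<close>
    also have "\<dots> = f t (int r + 1) + f t (int r - 1) +
        ((if r = p then poly u t else 0) + (if r = q then poly v t else 0))"
      using r pq by (simp add: f_step c_sum)
    also have "f t (int r + 1) + f t (int r - 1) = (?A *\<^sub>v vec n (\<lambda>r. poly (X r) t)) $ r"
      unfolding X using adjacency_cycle_mult_vec[OF n _ r, of "f t"] f_per by simp
    also have "(if r = p then poly u t else 0) + (if r = q then poly v t else 0) =
        (?B *\<^sub>v vec 2 (\<lambda>s. poly (U s) t)) $ r"
      using r ij by (simp add: input_matrix_pair scalar_prod_def numeral_2_eq_2 U_def p_def q_def)
    finally show "poly (pderiv (X r)) t =
        (?A *\<^sub>v vec n (\<lambda>r. poly (X r) t) + ?B *\<^sub>v vec 2 (\<lambda>s. poly (U s) t)) $ r"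
      using r A B by simp
  qed
  have "vec n (\<lambda>r. poly (X r) 0) = x0"
    using x0 ab0 by (intro eq_vecI) (simp_all add: X f_def \<alpha>(2)[OF \<rho>] \<beta>(2)[OF \<rho>])
  moreover have "vec n (\<lambda>r. poly (X r) 1) = x1"
    using x1 ab1 by (intro eq_vecI) (simp_all add: X f_def \<alpha>(3)[OF \<rho>] \<beta>(3)[OF \<rho>])
  ultimately show "\<exists>T>0. \<exists>u x. is_trajectory ?A ?B T u x \<and> x 0 = x0 \<and> x T = x1"
    using traj by (intro exI[of _ 1]) (auto intro!: exI)
qed

theorem theorem20:
  fixes n i j :: nat
  assumes "n \<ge> 3" and "i \<in> {1..n}" and "j \<in> {1..n}" and "i \<noteq> j"
  shows "driver_set n (cycle_graph n) {i, j} \<longleftrightarrow>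
    gcd (2 * graph_dist (cycle_graph n) i j) n \<in> {1, 2}"
proof -
  \<comment> \<open>The columns of the input matrix follow increasing vertex order, so ordered pairs
    come first; symmetry of the distance gives the rest.\<close>
  have *: "driver_set n (cycle_graph n) {p, q} \<longleftrightarrow> gcd (2 * graph_dist (cycle_graph n) p q) n \<in> {1, 2}"
    if "p \<in> {1..n}" "q \<in> {1..n}" "p < q" for p q
  proof -
    have pq: "1 \<le> p" "p < q" "q \<le> n" using that by auto
    have "driver_set n (cycle_graph n) {p, q} \<longleftrightarrow>
        controllable (adjacency_matrix n (cycle_graph n)) (input_matrix n {p, q})"
      using that by (simp add: driver_set_def)
    also have "\<dots> \<longleftrightarrow> gcd (2 * (q - p)) n \<in> {1, 2}"
    proof (cases "gcd (2 * (q - p)) n \<in> {1, 2}")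
      case True
      then show ?thesis using controllable_cycle[OF assms(1) pq True] by blast
    next
      case False
      then show ?thesis using not_controllable_cycle[OF assms(1) pq False] by blast
    qed
    finally show ?thesis unfolding gcd_graph_dist_cycle_graph[OF pq] .
  qed
  show ?thesis
  proof (cases "i < j")
    case True
    show ?thesis by (rule *[OF assms(2,3) True])
  next
    case False
    then have "j < i" using assms(4) by simp
    from *[OF assms(3,2) this] show ?thesis
      unfolding insert_commute[of i j "{}"] graph_dist_commute[of _ i j] .
  qed
qed

end
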